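(* For every $M>0$ there exists a unique solution $\xi:[0,\infty)\to\mathbb R$ of the ordinary differential equation $$\xi''(y)+\frac14\,\xi'(y)-\frac1{2y}\,\xi(y)\,\xi'(y)=0,\qquad y>0,$$ satisfying $\xi(0)=0$ and $\lim_{y\to\infty}\xi(y)=M$.
   Context: A solution on $[0,\infty)$ is a function $\xi\in C^1([0,\infty))\cap C^2((0,\infty))$ satisfying the equation pointwise for $y>0$. *)

theory Defs
  imports Complex_Main "HOL-Library.FuncSet"
begin

text \<open>
  The witnesses \<open>\<xi>'\<close> and \<open>\<xi>''\<close> are the first derivative on \<open>[0,\<infinity>)\<close> (one-sided at \<open>0\<close>) and the
  second derivative on \<open>(0,\<infinity>)\<close>; they are unique there, and their continuity expresses
  \<open>C\<^sup>1([0,\<infinity>)) \<inter> C\<^sup>2((0,\<infinity>))\<close>.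
\<close>

definition is_solution :: "(real \<Rightarrow> real) \<Rightarrow> bool" where
  "is_solution \<xi> \<longleftrightarrow>
    (\<exists>\<xi>' \<xi>''.
      (\<forall>y\<ge>0. (\<xi> has_real_derivative \<xi>' y) (at y within {0..})) \<and>
      continuous_on {0..} \<xi>' \<and>
      (\<forall>y>0. (\<xi>' has_real_derivative \<xi>'' y) (at y)) \<and>
      continuous_on {0<..} \<xi>'' \<and>
      (\<forall>y>0. \<xi>'' y + 1 / 4 * \<xi>' y - 1 / (2 * y) * \<xi> y * \<xi>' y = 0))"

end

theory Submission
  imports Defs "HOL-Analysis.Analysis"
begin

text \<open>
  Put \<open>a = \<xi>' 0\<close> and \<open>w y = \<xi> y / y\<close>. The equation integrates to
  \<open>\<xi>' y = a * exp (\<integral>\<^sub>0\<^sup>y w / 2 - y / 4)\<close>, so \<open>w\<close> is a fixed point of a monotone operator; for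
  \<open>0 \<le> a \<le> 1 / 2\<close> the iteration started at \<open>w = 1 / 2\<close> (the solution \<open>\<xi> y = y / 2\<close>) decreases to one.
  Solutions with \<open>a < b\<close> are ordered, even \<open>b * \<xi>\<^sub>a \<le> a * \<xi>\<^sub>b\<close>, so the limit at infinity determines
  \<open>a\<close>, and Gronwall's inequality shows that \<open>a\<close> determines the solution. For \<open>a < 1 / 2\<close> the
  limit exists and depends continuously on \<open>a\<close>; it is \<open>0\<close> at \<open>a = 0\<close> and unbounded as
  \<open>a\<close> tends to \<open>1 / 2\<close>, so the intermediate value theorem gives every \<open>M > 0\<close>.
\<close>

section \<open>Calculus on the closed half-line\<close>

lemma at_within_atLeast_eq: "at y within {0..} = at y" if "0 < y" for y :: real
  by (rule at_within_interior) (use that in simp)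

lemma at_within_Icc_eq: "at y within {0..y + 1} = at y within {0..}" if "0 \<le> y" for y :: real
proof (rule at_within_nhd)
  show "y \<in> {..<y + 1}" "open {..<y + 1}"
    by simp_all
  show "{0..y + 1} \<inter> {..<y + 1} - {y} = {0..} \<inter> {..<y + 1} - {y}"
    by force
qed

lemma continuous_on_atLeastI:
  fixes f :: "real \<Rightarrow> real"
  assumes "\<And>y. continuous_on {0..y} f"
  shows "continuous_on {0..} f"
proof -
  have "continuous (at y within {0..}) f" if "0 \<le> y" for y
  proof -
    have "continuous (at y within {0..y + 1}) f"
      using assms[of "y + 1"] that by (simp add: continuous_on_eq_continuous_within)
    then show ?thesis
      by (simp only: at_within_Icc_eq[OF that])
  qed
  then show ?thesis
    by (simp add: continuous_on_eq_continuous_within)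
qed

lemma integrable_on_Icc:
  fixes f :: "real \<Rightarrow> real"
  assumes "continuous_on {0..} f"
  shows "f integrable_on {0..y}"
  by (rule integrable_continuous_interval, rule continuous_on_subset[OF assms]) auto

lemma has_real_derivative_integral:
  fixes f :: "real \<Rightarrow> real"
  assumes "continuous_on {0..} f" "0 \<le> y"
  shows "((\<lambda>x. integral {0..x} f) has_real_derivative f y) (at y within {0..})"
proof -
  have "((\<lambda>x. integral {0..x} f) has_real_derivative f y) (at y within {0..y + 1})"
    by (rule integral_has_real_derivative, rule continuous_on_subset[OF assms(1)])
      (use assms(2) in auto)
  then show ?thesis
    by (simp add: at_within_Icc_eq assms(2))
qed

text \<open>The singularity at 0 is removable: as \<open>F 0 = 0\<close>, the quotient is the
  difference quotient at 0. This makes both \<xi> y / y and \<open>picard\<close> continuous up to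
  the boundary.\<close>

lemma continuous_on_quotient_at_0:
  fixes F :: "real \<Rightarrow> real"
  assumes "continuous_on {0..} F" "F 0 = 0" "(F has_real_derivative a) (at 0 within {0..})"
  shows "continuous_on {0..} (\<lambda>y. if y = 0 then a else F y / y)"
proof -
  let ?q = "\<lambda>y. if y = 0 then a else F y / y"
  have "continuous (at y within {0..}) ?q" if "0 \<le> y" for y
  proof (cases "y = 0")
    case True
    have "((\<lambda>y. F y / y) \<longlongrightarrow> a) (at 0 within {0..})"
      using assms(2,3) by (simp add: has_field_derivative_iff)
    then have "(?q \<longlongrightarrow> a) (at 0 within {0..})"
      by (rule Lim_transform_eventually) (auto simp: eventually_at_filter)
    then show ?thesis
      using True by (simp add: continuous_within)
  next
    case False
    with that have y: "0 < y" by simp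
    have "isCont F y"
      using assms(1) y that
      by (metis at_within_atLeast_eq atLeast_iff continuous_on_eq_continuous_within)
    then have "isCont (\<lambda>y. F y / y) y"
      using y by (intro continuous_intros) auto
    moreover have "\<forall>\<^sub>F x in nhds y. ?q x = F x / x"
      by (rule eventually_mono[OF eventually_nhds_in_open[of "{0<..}" y]]) (use y in auto)
    ultimately have "isCont ?q y"
      by (simp add: isCont_cong)
    then show ?thesis
      by (simp add: at_within_atLeast_eq y)
  qed
  then show ?thesis
    by (simp add: continuous_on_eq_continuous_within)
qed

subsection \<open>The integrated equation\<close>

definition flux :: "real \<Rightarrow> (real \<Rightarrow> real) \<Rightarrow> real \<Rightarrow> real" where
  "flux a w y = a * exp (integral {0..y} w / 2 - y / 4)"

text \<open>Working with \<open>w\<close> in place of \<xi> hides the singular coefficient of the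
  equation. At \<open>y = 0\<close> the integral identity reads 0 = 0, so the slope is prescribed by
  \<open>w 0 = a\<close>.\<close>

definition mild_solution :: "real \<Rightarrow> (real \<Rightarrow> real) \<Rightarrow> bool" where
  "mild_solution a w \<longleftrightarrow>
    continuous_on {0..} w \<and> w 0 = a \<and> (\<forall>y\<ge>0. y * w y = integral {0..y} (flux a w))"

lemma flux_0 [simp]: "flux a w 0 = a"
  by (simp add: flux_def)

lemma continuous_on_flux:
  assumes "\<And>y. w integrable_on {0..y}"
  shows "continuous_on {0..} (flux a w)"
proof (rule continuous_on_atLeastI)
  fix y
  show "continuous_on {0..y} (flux a w)"
    unfolding flux_def
    by (intro continuous_intros indefinite_integral_continuous_1 assms) auto
qed

lemma integral_le_linear:
  assumes "\<And>y. w integrable_on {0..y}" "\<And>y. 0 \<le> y \<Longrightarrow> w y \<le> c" "0 \<le> y"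
  shows "integral {0..y} w \<le> c * (y::real)"
proof -
  have "integral {0..y} w \<le> integral {0..y} (\<lambda>_. c)"
    by (rule integral_le) (use assms in auto)
  then show ?thesis using assms(3) by (simp add: mult.commute)
qed

text \<open>Used in two ways: \<open>c = 1 / 2\<close> gives the constant bound \<open>a\<close>,
  while \<open>c < 1 / 2\<close> gives exponential decay.\<close>

lemma flux_le_exp:
  assumes "\<And>y. w integrable_on {0..y}" "\<And>y. 0 \<le> y \<Longrightarrow> w y \<le> c" "0 \<le> a" "0 \<le> y"
  shows "flux a w y \<le> a * exp (- (1 / 4 - c / 2) * y)"
  unfolding flux_def
  using integral_le_linear[OF assms(1,2,4)] assms(3)
  by (intro mult_left_mono) (auto simp: algebra_simps)

lemma flux_mono:
  assumes "\<And>y. w integrable_on {0..y}" "\<And>y. v integrable_on {0..y}"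
    and "\<And>s. 0 \<le> s \<Longrightarrow> s \<le> y \<Longrightarrow> w s \<le> v s" "0 \<le> a"
  shows "flux a w y \<le> flux a v y"
proof -
  have "integral {0..y} w \<le> integral {0..y} v"
    by (rule integral_le) (use assms in auto)
  then show ?thesis
    using assms(4) by (auto simp: flux_def intro!: mult_left_mono)
qed

section \<open>Existence by monotone iteration\<close>

definition picard :: "real \<Rightarrow> (real \<Rightarrow> real) \<Rightarrow> real \<Rightarrow> real" where
  "picard a w y = (if y = 0 then a else integral {0..y} (flux a w) / y)"

lemma continuous_on_picard:
  assumes "\<And>y. w integrable_on {0..y}"
  shows "continuous_on {0..} (picard a w)"
proof -
  let ?F = "\<lambda>y. integral {0..y} (flux a w)"
  have F: "(?F has_real_derivative flux a w y) (at y within {0..})" if "0 \<le> y" for y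
    using has_real_derivative_integral[OF continuous_on_flux[OF assms] that] .
  have "continuous_on {0..} (\<lambda>y. if y = 0 then a else ?F y / y)"
    using F[of 0] DERIV_continuous_on[of "{0..}" ?F "flux a w"] F
    by (intro continuous_on_quotient_at_0) auto
  then show ?thesis
    by (simp add: picard_def[abs_def])
qed

lemma picard_mono:
  assumes "\<And>y. w integrable_on {0..y}" "\<And>y. v integrable_on {0..y}"
    and "\<And>s. 0 \<le> s \<Longrightarrow> w s \<le> v s" "0 \<le> a" "0 \<le> y"
  shows "picard a w y \<le> picard a v y"
proof -
  have "integral {0..y} (flux a w) \<le> integral {0..y} (flux a v)"
    by (intro integral_le integrable_on_Icc[OF continuous_on_flux] flux_mono) (use assms in auto)
  then show ?thesis
    using assms(5) by (auto simp: picard_def divide_right_mono)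
qed

lemma picard_nonneg:
  assumes "\<And>y. w integrable_on {0..y}" "0 \<le> a" "0 \<le> y"
  shows "0 \<le> picard a w y"
proof -
  have "0 \<le> integral {0..y} (flux a w)"
    by (intro integral_nonneg integrable_on_Icc[OF continuous_on_flux])
      (use assms in \<open>auto simp: flux_def\<close>)
  then show ?thesis
    using assms by (auto simp: picard_def)
qed

text \<open>At \<open>w = 1 / 2\<close> the exponent in \<open>flux\<close> vanishes. This yields
  the first step of the iteration and, for \<open>a = 1 / 2\<close>, an explicit fixed
  point.\<close>

lemma picard_half:
  assumes "0 \<le> y"
  shows "picard a (\<lambda>_. 1 / 2) y = a"
proof -
  have "integral {0..y} (flux a (\<lambda>_. 1 / 2)) = integral {0..y} (\<lambda>_. a)"
    by (rule integral_cong) (auto simp: flux_def)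
  then show ?thesis
    using assms by (simp add: picard_def)
qed

lemma mild_solution_half: "mild_solution (1 / 2) (\<lambda>_. 1 / 2)"
  unfolding mild_solution_def
proof (intro conjI allI impI)
  fix y :: real assume "0 \<le> y"
  then show "y * (1 / 2) = integral {0..y} (flux (1 / 2) (\<lambda>_. 1 / 2))"
    using picard_half[of y "1/2"] by (auto simp: picard_def split: if_splits)
qed auto

text \<open>Because \<open>a \<le> 1 / 2\<close>, the first step goes down, and monotonicity of
  \<open>picard\<close> makes the whole sequence decrease; it stays nonnegative. Dominated
  convergence passes to the limit twice, inside the exponential and in the outer integral.\<close>

lemma mild_solution_exists:
  assumes "0 \<le> a" "a \<le> 1 / 2"
  shows "\<exists>w. mild_solution a w \<and> (\<forall>y\<ge>0. w y \<le> 1 / 2)"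
proof -
  define W where "W n = (picard a ^^ n) (\<lambda>_. 1 / 2)" for n
  have W_Suc: "W (Suc n) = picard a (W n)" for n
    by (simp add: W_def)
  have cont: "continuous_on {0..} (W n)" for n
    by (induction n) (auto simp: W_def intro!: continuous_on_picard integrable_on_Icc)
  note int = integrable_on_Icc[OF cont]
  have decr: "W (Suc n) y \<le> W n y" if "0 \<le> y" for n y
    using that
  proof (induction n arbitrary: y)
    case 0
    then show ?case using assms by (simp add: W_def picard_half)
  next
    case (Suc n)
    then show ?case
      unfolding W_Suc[of "Suc n"] W_Suc[of n]
      by (intro picard_mono) (use Suc.IH int assms in \<open>auto simp flip: W_Suc\<close>)
  qed
  have dec: "decseq (\<lambda>n. W n y)" if "0 \<le> y" for y
    using decr[OF that] by (rule decseq_SucI)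
  have nn: "0 \<le> W n y" if "0 \<le> y" for n y
    by (cases n) (use that assms int in \<open>auto simp: W_Suc intro: picard_nonneg\<close>, simp add: W_def)
  have le: "W n y \<le> 1 / 2" if "0 \<le> y" for n y
    using decseqD[OF dec[OF that], of 0 n] by (simp add: W_def)
  define w where "w y = lim (\<lambda>n. W n y)" for y
  have lim: "(\<lambda>n. W n y) \<longlonglongrightarrow> w y" if "0 \<le> y" for y
  proof -
    have "convergent (\<lambda>n. W n y)"
      using decseq_convergent[OF dec[OF that], of 0] nn[OF that] unfolding convergent_def by blast
    then show ?thesis
      by (simp add: convergent_LIMSEQ_iff w_def)
  qed
  have "w integrable_on {0..y} \<and>
      (\<lambda>n. integral {0..y} (W n)) \<longlonglongrightarrow> integral {0..y} w" for y
    using dominated_convergence[of W "{0..y}" "\<lambda>_. 1 / 2" w] int nn le lim by auto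
  then have w_int: "w integrable_on {0..y}"
    and lim_int: "(\<lambda>n. integral {0..y} (W n)) \<longlonglongrightarrow> integral {0..y} w" for y
    by blast+
  have lim_flux: "(\<lambda>n. flux a (W n) y) \<longlonglongrightarrow> flux a w y" for y
    unfolding flux_def by (intro tendsto_intros lim_int) auto
  have flux_bd: "\<bar>flux a (W n) y\<bar> \<le> a" if "0 \<le> y" for n y
  proof -
    have "flux a (W n) y \<le> a * exp (- (1 / 4 - 1 / 2 / 2) * y)"
      by (rule flux_le_exp) (use int le that assms in auto)
    then show ?thesis
      using assms by (simp add: flux_def)
  qed
  have "(\<lambda>n. integral {0..y} (flux a (W n))) \<longlonglongrightarrow> integral {0..y} (flux a w)" for y
    by (rule dominated_convergence(2)[where h = "\<lambda>_. a"])
      (use integrable_on_Icc[OF continuous_on_flux[OF int]] flux_bd lim_flux in auto)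
  then have lim_picard: "(\<lambda>n. picard a (W n) y) \<longlonglongrightarrow> picard a w y" if "0 \<le> y" for y
    using that by (cases "y = 0") (auto simp: picard_def intro!: tendsto_intros)
  have fp: "picard a w y = w y" if "0 \<le> y" for y
    by (rule LIMSEQ_unique[OF lim_picard LIMSEQ_Suc[OF lim, unfolded W_Suc]]) (use that in auto)
  \<comment> \<open>A pointwise limit need not be continuous, but \<open>picard a w\<close> is
    continuous once \<open>w\<close> is integrable, and \<open>w\<close> agrees with it on
    \<open>{0..}\<close>.\<close>
  have "continuous_on {0..} w"
    by (rule continuous_on_eq[OF continuous_on_picard[OF w_int, of a]]) (simp add: fp)
  moreover have "y * w y = integral {0..y} (flux a w)" if "0 \<le> y" for y
    using fp[OF that] by (auto simp: picard_def divide_eq_eq mult.commute split: if_splits)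
  moreover have "w y \<le> 1 / 2" if "0 \<le> y" for y
    using LIMSEQ_le_const2[OF lim[OF that]] le[OF that] by blast
  ultimately show ?thesis
    using fp[of 0] by (auto simp: mild_solution_def picard_def)
qed

section \<open>Basic properties of mild solutions\<close>

lemma mild_solutionD:
  assumes "mild_solution a w"
  shows mild_solution_continuous_on: "continuous_on {0..} w"
    and mild_solution_at_0: "w 0 = a"
    and mild_solution_eq: "0 \<le> y \<Longrightarrow> y * w y = integral {0..y} (flux a w)"
    and mild_solution_integrable: "w integrable_on {0..y}"
    and mild_solution_flux_integrable: "flux a w integrable_on {0..y}"
    and mild_solution_continuous_on_flux: "continuous_on {0..} (flux a w)"
proof -
  show cont: "continuous_on {0..} w" and "w 0 = a"
    and "0 \<le> y \<Longrightarrow> y * w y = integral {0..y} (flux a w)"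
    using assms by (auto simp: mild_solution_def)
  show "w integrable_on {0..y}"
    by (rule integrable_on_Icc[OF cont])
  show flux: "continuous_on {0..} (flux a w)"
    by (rule continuous_on_flux[OF integrable_on_Icc[OF cont]])
  show "flux a w integrable_on {0..y}"
    by (rule integrable_on_Icc[OF flux])
qed

lemma mild_solution_has_derivative:
  assumes "mild_solution a w" "0 \<le> y"
  shows "((\<lambda>x. x * w x) has_real_derivative flux a w y) (at y within {0..})"
  unfolding has_field_derivative_def
  by (rule has_derivative_transform[OF _ _
        has_real_derivative_integral[OF mild_solution_continuous_on_flux[OF assms(1)] assms(2),
          unfolded has_field_derivative_def]])
    (use assms(2) mild_solution_eq[OF assms(1)] in auto)

lemma mild_solution_has_derivative_at:
  assumes "mild_solution a w" "0 < y"
  shows "((\<lambda>x. x * w x) has_real_derivative flux a w y) (at y)"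
  using mild_solution_has_derivative[OF assms(1), of y] assms(2) by (simp add: at_within_atLeast_eq)

lemma mild_solution_continuous_on_Icc:
  assumes "mild_solution a w" "0 \<le> x"
  shows "continuous_on {x..y} (\<lambda>x. x * w x)"
  by (rule continuous_on_mult[OF continuous_on_id
        continuous_on_subset[OF mild_solution_continuous_on[OF assms(1)]]])
    (use assms(2) in auto)

lemma mild_solution_pos:
  assumes "mild_solution a w" "0 < a" "0 \<le> y"
  shows "0 < w y"
proof (cases "y = 0")
  case True
  then show ?thesis using assms mild_solution_at_0[OF assms(1)] by simp
next
  case False
  then have y: "0 < y" using assms by simp
  have "0 * w 0 < y * w y"
  proof (rule DERIV_pos_imp_increasing_open[OF y])
    fix x :: real assume "0 < x" "x < y"
    then show "\<exists>z. ((\<lambda>x. x * w x) has_real_derivative z) (at x) \<and> 0 < z"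
      using mild_solution_has_derivative_at[OF assms(1), of x] assms(2)
      by (auto simp: flux_def)
  qed (rule mild_solution_continuous_on_Icc[OF assms(1) order.refl])
  then show ?thesis
    using y by (simp add: zero_less_mult_iff)
qed

lemma mild_solution_mono:
  assumes "mild_solution a w" "0 \<le> a" "0 \<le> x" "x \<le> y"
  shows "x * w x \<le> y * w y"
proof (rule DERIV_nonneg_imp_increasing_open[OF assms(4)])
  fix z :: real assume "x < z" "z < y"
  then show "\<exists>d. ((\<lambda>x. x * w x) has_real_derivative d) (at z) \<and> 0 \<le> d"
    using mild_solution_has_derivative_at[OF assms(1), of z] assms
    by (auto simp: flux_def)
qed (rule mild_solution_continuous_on_Icc[OF assms(1,3)])

lemma flux_scale: "b * flux a w y = a * flux b w y"
  by (simp add: flux_def)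

subsection \<open>Dependence on the initial slope\<close>

text \<open>
  If the two functions met, then up to the first meeting point the slopes would satisfy
  \<open>b * flux a w \<le> a * flux b v\<close>, and integration would contradict the equality there.
\<close>

lemma mild_solution_less:
  assumes w: "mild_solution a w" and v: "mild_solution b v" and ab: "0 \<le> a" "a < b"
    and "0 \<le> y"
  shows "w y < v y"
proof (rule ccontr)
  define S where "S = {x \<in> {0..y}. v x - w x = 0}"
  have cont: "continuous_on {0..s} (\<lambda>x. v x - w x)" for s
    by (rule continuous_on_subset[OF continuous_on_diff[OF mild_solution_continuous_on[OF v]
            mild_solution_continuous_on[OF w]]]) auto
  have zero: "\<exists>x\<in>{0..s}. v x - w x = 0" if "0 \<le> s" "\<not> w s < v s" for s
  proof -
    have "\<exists>x\<ge>0. x \<le> s \<and> v x - w x = 0"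
      by (rule IVT2'[OF _ _ that(1) cont])
        (use that ab mild_solution_at_0[OF w] mild_solution_at_0[OF v] in auto)
    then show ?thesis by auto
  qed
  assume "\<not> w y < v y"
  then have "S \<noteq> {}"
    using zero[OF \<open>0 \<le> y\<close>] by (auto simp: S_def)
  moreover have bdd: "bdd_below S"
    by (rule bdd_belowI[of _ 0]) (simp add: S_def)
  moreover have "closed S"
    unfolding S_def
    by (intro continuous_closed_preimage_constant cont closed_atLeastAtMost)
  ultimately have "Inf S \<in> S"
    by (rule closed_contains_Inf)
  define z where "z = Inf S"
  have z: "0 \<le> z" "z \<le> y" "w z = v z"
    using \<open>Inf S \<in> S\<close> by (auto simp: S_def z_def)
  have le: "w s \<le> v s" if s: "0 \<le> s" "s \<le> z" for s
  proof (cases "s = z")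
    case False
    show ?thesis
    proof (rule ccontr)
      assume "\<not> w s \<le> v s"
      then obtain x where x: "x \<in> {0..s}" "v x - w x = 0"
        using zero[OF s(1)] by force
      then have "x \<in> S"
        using s z by (auto simp: S_def)
      then have "z \<le> x"
        unfolding z_def using bdd by (rule cInf_lower)
      then show False
        using x s False by auto
    qed
  qed (simp add: z)
  have "integral {0..z} (\<lambda>s. b * flux a w s) \<le> integral {0..z} (\<lambda>s. a * flux b v s)"
  proof (rule integral_le)
    fix s assume s: "s \<in> {0..z}"
    have "flux a w s \<le> flux a v s"
      by (rule flux_mono) (use s le ab mild_solution_integrable w v in auto)
    then have "b * flux a w s \<le> b * flux a v s"
      using ab by (intro mult_left_mono) auto
    then show "b * flux a w s \<le> a * flux b v s"
      by (simp add: flux_scale)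
  qed (use mild_solution_flux_integrable w v in \<open>auto intro!: integrable_on_mult_right\<close>)
  \<comment> \<open>As \<open>w z = v z\<close> and \<open>z * v z\<close> is positive, this forces
    \<open>b \<le> a\<close>. The point \<open>z\<close> is not 0 because the values there are
    \<open>a < b\<close>.\<close>
  then have "b * (z * w z) \<le> a * (z * v z)"
    using z(1) by (simp add: mild_solution_eq[OF w] mild_solution_eq[OF v])
  moreover have "0 < v z"
    by (rule mild_solution_pos[OF v]) (use ab z in auto)
  moreover have "0 < z"
    using z ab mild_solution_at_0[OF w] mild_solution_at_0[OF v] by (cases "z = 0") auto
  ultimately show False
    using z ab by (simp add: mult_le_cancel_right)
qed

lemma mild_solution_flux_le:
  assumes w: "mild_solution a w" and v: "mild_solution b v" and ab: "0 \<le> a" "a < b"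
    and "0 \<le> y"
  shows "b * flux a w y \<le> a * flux b v y"
proof -
  have "flux a w y \<le> flux a v y"
    by (rule flux_mono) (use mild_solution_less[OF w v ab] mild_solution_integrable w v ab in
        \<open>auto intro: less_imp_le\<close>)
  then have "b * flux a w y \<le> b * flux a v y"
    using ab by (intro mult_left_mono) auto
  then show ?thesis
    by (simp add: flux_scale)
qed

text \<open>A strict order could degenerate to equality as \<open>y\<close> tends to infinity. The
  proportional gap survives the limit, so different slopes cannot share a positive limit.\<close>

lemma mild_solution_scale_le:
  assumes w: "mild_solution a w" and v: "mild_solution b v" and ab: "0 \<le> a" "a < b"
    and y: "0 \<le> y"
  shows "b * (y * w y) \<le> a * (y * v y)"
proof -
  have "integral {0..y} (\<lambda>s. b * flux a w s) \<le> integral {0..y} (\<lambda>s. a * flux b v s)"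
    by (intro integral_le integrable_on_mult_right mild_solution_flux_integrable[OF w]
        mild_solution_flux_integrable[OF v] mild_solution_flux_le[OF w v ab]) auto
  then show ?thesis
    using y by (simp add: mild_solution_eq[OF w] mild_solution_eq[OF v])
qed

text \<open>The ordering of the solutions orders their slopes as well, so the gap has nonnegative
  derivative. This controls the tails uniformly in the slope.\<close>

lemma mild_solution_diff_mono:
  assumes w: "mild_solution a w" and v: "mild_solution b v" and ab: "0 \<le> a" "a < b"
    and xy: "0 \<le> x" "x \<le> y"
  shows "x * v x - x * w x \<le> y * v y - y * w y"
proof (rule DERIV_nonneg_imp_increasing_open[OF xy(2)])
  fix z :: real assume z: "x < z" "z < y"
  have "flux a w z \<le> flux a v z"
    by (rule flux_mono) (use mild_solution_less[OF w v ab] mild_solution_integrable w v ab in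
        \<open>auto intro: less_imp_le\<close>)
  also have "\<dots> \<le> flux b v z"
    using ab by (simp add: flux_def)
  finally show "\<exists>d. ((\<lambda>x. x * v x - x * w x) has_real_derivative d) (at z) \<and> 0 \<le> d"
    using z xy
    by (intro exI[of _ "flux b v z - flux a w z"] conjI DERIV_diff
        mild_solution_has_derivative_at[OF w] mild_solution_has_derivative_at[OF v]) auto
qed (rule continuous_on_diff[OF mild_solution_continuous_on_Icc[OF v xy(1)]
      mild_solution_continuous_on_Icc[OF w xy(1)]])

section \<open>Lipschitz dependence on the slope\<close>

lemma abs_exp_diff_le:
  fixes x y :: real
  assumes "x \<le> 0" "y \<le> 0"
  shows "\<bar>exp x - exp y\<bar> \<le> \<bar>x - y\<bar>"
proof -
  have *: "exp q - exp p \<le> q - p" if "p \<le> q" "q \<le> 0" for p q :: real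
  proof -
    have "1 - exp (p - q) \<le> q - p"
      using exp_ge_add_one_self[of "p - q"] by linarith
    moreover have "exp q * (1 - exp (p - q)) \<le> 1 * (1 - exp (p - q))"
      using that by (intro mult_right_mono) auto
    moreover have "exp q * exp (p - q) = exp p"
      by (simp flip: exp_add)
    ultimately show ?thesis
      by (simp add: right_diff_distrib)
  qed
  show ?thesis
    using *[of x y] *[of y x] assms by (cases "x \<le> y") auto
qed

text \<open>A Gronwall argument for the integral \<open>D\<close> of the difference. The bounds by
  \<open>1 / 2\<close> keep both exponents nonpositive, where \<open>exp\<close> is
  1-Lipschitz.\<close>

lemma mild_solution_lipschitz:
  assumes w: "mild_solution a w" and v: "mild_solution b v"
    and a: "0 \<le> a" "a \<le> 1 / 2"
    and le: "\<And>y. 0 \<le> y \<Longrightarrow> w y \<le> 1 / 2" "\<And>y. 0 \<le> y \<Longrightarrow> v y \<le> 1 / 2"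
    and y: "0 \<le> y"
  shows "\<bar>w y - v y\<bar> \<le> \<bar>a - b\<bar> * exp (y / 4)"
proof -
  define D where "D y = integral {0..y} (\<lambda>s. \<bar>w s - v s\<bar>)" for y
  have cont: "continuous_on {0..} (\<lambda>s. \<bar>w s - v s\<bar>)"
    by (rule continuous_on_rabs[OF continuous_on_diff[OF mild_solution_continuous_on[OF w]
            mild_solution_continuous_on[OF v]]])
  note int = integrable_on_Icc[OF cont] mild_solution_integrable[OF w] mild_solution_integrable[OF v]
  have D_mono: "D s \<le> D t" if "s \<le> t" for s t
    unfolding D_def using that by (intro integral_subset_le int) auto
  have D_nn: "0 \<le> D s" for s
    unfolding D_def by (intro integral_nonneg int) auto
  \<comment> \<open>The factor 1/4 is the product of \<open>a \<le> 1 / 2\<close> and the 1/2 in the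
    exponent of \<open>flux\<close>.\<close>
  have flux_diff: "\<bar>flux a w s - flux b v s\<bar> \<le> \<bar>a - b\<bar> + D s / 4" if s: "0 \<le> s" for s
  proof -
    let ?p = "integral {0..s} w / 2 - s / 4" and ?q = "integral {0..s} v / 2 - s / 4"
    have neg: "?p \<le> 0" "?q \<le> 0"
      using integral_le_linear[OF int(2) le(1) s] integral_le_linear[OF int(3) le(2) s] by auto
    have "integral {0..s} w - integral {0..s} v = integral {0..s} (\<lambda>x. w x - v x)"
      by (rule Henstock_Kurzweil_Integration.integral_diff[symmetric]) (rule int)+
    also have "\<bar>\<dots>\<bar> \<le> D s"
      unfolding D_def using integral_norm_bound_integral[of "\<lambda>x. w x - v x" "{0..s}" "\<lambda>x. \<bar>w x - v x\<bar>"] int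
      by (simp add: integrable_diff)
    finally have "\<bar>?p - ?q\<bar> \<le> D s / 2"
      by (simp add: abs_if field_simps split: if_splits)
    then have "\<bar>exp ?p - exp ?q\<bar> \<le> D s / 2"
      using abs_exp_diff_le[OF neg] by linarith
    then have "a * \<bar>exp ?p - exp ?q\<bar> \<le> 1 / 2 * (D s / 2)"
      using a by (intro mult_mono) auto
    moreover have "\<bar>a - b\<bar> * exp ?q \<le> \<bar>a - b\<bar> * 1"
      using neg by (intro mult_left_mono) auto
    moreover have "flux a w s - flux b v s = a * (exp ?p - exp ?q) + (a - b) * exp ?q"
      by (simp add: flux_def algebra_simps)
    then have "\<bar>flux a w s - flux b v s\<bar> \<le> a * \<bar>exp ?p - exp ?q\<bar> + \<bar>a - b\<bar> * exp ?q"
      using a abs_triangle_ineq[of "a * (exp ?p - exp ?q)" "(a - b) * exp ?q"]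
      by (simp add: abs_mult)
    ultimately show ?thesis by simp
  qed
  \<comment> \<open>Away from 0, \<open>w s - v s\<close> is the mean of the flux difference over
    \<open>{0..s}\<close>, and \<open>D\<close> is monotone, so the bound at \<open>s\<close> serves
    for the whole interval.\<close>
  have diff_le: "\<bar>w s - v s\<bar> \<le> \<bar>a - b\<bar> + D s / 4" if s: "0 \<le> s" for s
  proof (cases "s = 0")
    case True
    then show ?thesis
      using D_nn[of 0] mild_solution_at_0[OF w] mild_solution_at_0[OF v] by simp
  next
    case False
    have "s * w s - s * v s = integral {0..s} (\<lambda>x. flux a w x - flux b v x)"
      using s mild_solution_flux_integrable w v
      by (simp add: mild_solution_eq[OF w] mild_solution_eq[OF v] Henstock_Kurzweil_Integration.integral_diff)
    also have "\<bar>\<dots>\<bar> \<le> integral {0..s} (\<lambda>_. \<bar>a - b\<bar> + D s / 4)"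
    proof (rule integral_norm_bound_integral[where 'a = real, unfolded real_norm_def])
      fix x assume "x \<in> {0..s}"
      then show "\<bar>flux a w x - flux b v x\<bar> \<le> \<bar>a - b\<bar> + D s / 4"
        using flux_diff[of x] D_mono[of x s] by auto
    qed (use mild_solution_flux_integrable w v in \<open>auto intro!: integrable_diff\<close>)
    finally have "s * \<bar>w s - v s\<bar> \<le> s * (\<bar>a - b\<bar> + D s / 4)"
      using s by (simp add: abs_mult flip: right_diff_distrib)
    then show ?thesis
      using s False by simp
  qed
  \<comment> \<open>By \<open>diff_le\<close>, the derivative of
    \<open>4 * \<bar>a - b\<bar> + D s\<close> is at most a quarter of that quantity; the
    integrating factor turns this into a nonincreasing function.\<close>
  let ?g = "\<lambda>s. (4 * \<bar>a - b\<bar> + D s) * exp (- s / 4)"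
  have D_deriv: "(D has_real_derivative \<bar>w s - v s\<bar>) (at s within {0..})" if "0 \<le> s" for s
    unfolding D_def[abs_def] using has_real_derivative_integral[OF cont that] .
  have "?g y \<le> ?g 0"
  proof (rule DERIV_nonpos_imp_decreasing_open[OF y, where f = ?g])
    fix s :: real assume s: "0 < s" "s < y"
    have "(?g has_real_derivative (\<bar>w s - v s\<bar> - (\<bar>a - b\<bar> + D s / 4)) * exp (- s / 4)) (at s)"
      using D_deriv[of s] s
      by (auto intro!: derivative_eq_intros simp: at_within_atLeast_eq algebra_simps)
    moreover have "(\<bar>w s - v s\<bar> - (\<bar>a - b\<bar> + D s / 4)) * exp (- s / 4) \<le> 0"
      using diff_le[of s] s by (intro mult_nonpos_nonneg) auto
    ultimately show "\<exists>d. (?g has_real_derivative d) (at s) \<and> d \<le> 0"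
      by blast
  next
    have "continuous_on {0..} D"
      by (rule DERIV_continuous_on[OF D_deriv]) auto
    then show "continuous_on {0..y} ?g"
      by (intro continuous_intros) (auto intro: continuous_on_subset)
  qed
  then have "4 * \<bar>a - b\<bar> + D y \<le> 4 * (\<bar>a - b\<bar> * exp (y / 4))"
    by (simp add: D_def exp_minus field_simps)
  then show ?thesis
    using diff_le[OF y] by simp
qed

text \<open>Comparison with the constant solution of slope 1/2 gives the bounds that the Lipschitz
  estimate requires; equal slopes then make its right side vanish.\<close>

lemma mild_solution_unique:
  assumes "mild_solution a w" "mild_solution a v" "0 \<le> a" "a < 1 / 2" "0 \<le> y"
  shows "w y = v y"
proof -
  have "u x \<le> 1 / 2" if "mild_solution a u" "0 \<le> x" for u x
    using mild_solution_less[OF that(1) mild_solution_half assms(3,4) that(2)] by simp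
  then have "\<bar>w y - v y\<bar> \<le> \<bar>a - a\<bar> * exp (y / 4)"
    by (intro mild_solution_lipschitz) (use assms in auto)
  then show ?thesis by simp
qed

section \<open>Boundedness and limits at infinity\<close>

text \<open>A bootstrap: comparison gives \<open>w \<le> 1 / 2\<close>, hence the flux is at most
  \<open>a\<close>, hence its mean \<open>w\<close> is at most \<open>a\<close>. Now the flux decays
  at rate \<open>1 / 4 - a / 2 > 0\<close> and has a finite integral.\<close>

lemma mild_solution_bounded:
  assumes w: "mild_solution a w" and a: "0 \<le> a" "a < 1 / 2" and y: "0 \<le> y"
  shows "y * w y \<le> a / (1 / 4 - a / 2)"
proof -
  let ?k = "1 / 4 - a / 2"
  have le: "w x \<le> 1 / 2" if "0 \<le> x" for x
    using mild_solution_less[OF w mild_solution_half a that] by simp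
  have flux_le: "flux a w x \<le> a" if "0 \<le> x" for x
    using flux_le_exp[OF mild_solution_integrable[OF w] le a(1) that] by simp
  have w_le: "w x \<le> a" if x: "0 \<le> x" for x
  proof (cases "x = 0")
    case False
    have "w x * x \<le> a * x"
      unfolding mult.commute[of "w x"] mild_solution_eq[OF w x]
      by (rule integral_le_linear[OF mild_solution_flux_integrable[OF w] flux_le x])
    then show ?thesis
      using x False by simp
  qed (simp add: mild_solution_at_0[OF w])
  \<comment> \<open>The added term has derivative \<open>- (a * exp (- ?k * x))\<close>, which
    cancels the bound on the flux, and it makes \<open>?g 0\<close> equal to the claimed
    bound.\<close>
  let ?g = "\<lambda>x. x * w x + a / ?k * exp (- ?k * x)"
  have k: "0 < ?k" using a by simp
  have "?g y \<le> ?g 0"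
  proof (rule DERIV_nonpos_imp_decreasing_open[OF y, where f = ?g])
    fix x assume x: "0 < x" "x < y"
    have "((\<lambda>x. a / ?k * exp (- ?k * x)) has_real_derivative
        a / ?k * (exp (- ?k * x) * (- ?k))) (at x)"
      by (intro DERIV_cmult DERIV_fun_exp DERIV_cmult_Id)
    moreover have "a / ?k * (exp (- ?k * x) * (- ?k)) = - (a * exp (- ?k * x))"
      using k by (simp add: divide_simps)
    ultimately have "((\<lambda>x. a / ?k * exp (- ?k * x)) has_real_derivative
        - (a * exp (- ?k * x))) (at x)"
      by (simp only:)
    then have "(?g has_real_derivative flux a w x + - (a * exp (- ?k * x))) (at x)"
      by (rule DERIV_add[OF mild_solution_has_derivative_at[OF w x(1)]])
    moreover have "flux a w x \<le> a * exp (- ?k * x)"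
      by (rule flux_le_exp[OF mild_solution_integrable[OF w] w_le]) (use a x in auto)
    ultimately show "\<exists>d. (?g has_real_derivative d) (at x) \<and> d \<le> 0"
      by (intro exI conjI) auto
  qed (intro continuous_on_add mild_solution_continuous_on_Icc[OF w] order.refl continuous_intros)
  moreover have "0 \<le> a / ?k * exp (- ?k * y)"
    using a k by simp
  ultimately show ?thesis by simp
qed

lemma bounded_mono_tendsto_at_top:
  fixes f :: "real \<Rightarrow> real"
  assumes mono: "\<And>x y. 0 \<le> x \<Longrightarrow> x \<le> y \<Longrightarrow> f x \<le> f y" and bd: "\<And>x. 0 \<le> x \<Longrightarrow> f x \<le> B"
  shows "\<exists>L. (f \<longlongrightarrow> L) at_top"
proof -
  let ?L = "SUP x\<in>{0..}. f x"
  have bdd: "bdd_above (f ` {0..})"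
    using bd by (intro bdd_aboveI[of _ B]) auto
  have "(f \<longlongrightarrow> ?L) at_top"
  proof (rule increasing_tendsto)
    show "\<forall>\<^sub>F x in at_top. f x \<le> ?L"
      using eventually_ge_at_top[of 0]
      by eventually_elim (use bdd in \<open>auto intro!: cSUP_upper\<close>)
  next
    fix l assume "l < ?L"
    then obtain x where x: "0 \<le> x" "l < f x"
      using less_cSUP_iff[OF _ bdd, of l] by auto
    show "\<forall>\<^sub>F y in at_top. l < f y"
      using eventually_ge_at_top[of x]
      by eventually_elim (use x mono in \<open>auto intro: less_le_trans\<close>)
  qed
  then show ?thesis ..
qed

lemma le_limit_at_top:
  fixes f :: "real \<Rightarrow> real"
  assumes "\<And>x y. 0 \<le> x \<Longrightarrow> x \<le> y \<Longrightarrow> f x \<le> f y" "(f \<longlongrightarrow> L) at_top" "0 \<le> x"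
  shows "f x \<le> L"
  by (rule tendsto_lowerbound[OF assms(2) eventually_mono[OF eventually_ge_at_top[of x]]])
    (use assms in auto)

subsection \<open>The limit at infinity as a function of the initial slope\<close>

definition profile :: "real \<Rightarrow> real \<Rightarrow> real" where
  "profile a = (SOME w. mild_solution a w \<and> (\<forall>y\<ge>0. w y \<le> 1 / 2))"

text \<open>The limit is shown to exist for \<open>0 \<le> a < 1 / 2\<close>; only there does
  \<open>Lim\<close> carry information.\<close>

definition mass :: "real \<Rightarrow> real" where
  "mass a = Lim at_top (\<lambda>y. y * profile a y)"

lemma profile:
  assumes "0 \<le> a" "a \<le> 1 / 2"
  shows mild_solution_profile: "mild_solution a (profile a)"
    and profile_le: "0 \<le> y \<Longrightarrow> profile a y \<le> 1 / 2"
  using someI_ex[OF mild_solution_exists[OF assms]] unfolding profile_def by auto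

lemma profile_tendsto_mass:
  assumes "0 \<le> a" "a < 1 / 2"
  shows "((\<lambda>y. y * profile a y) \<longlongrightarrow> mass a) at_top"
proof -
  have w: "mild_solution a (profile a)"
    using assms by (intro mild_solution_profile) auto
  obtain L where "((\<lambda>y. y * profile a y) \<longlongrightarrow> L) at_top"
    using bounded_mono_tendsto_at_top[where f = "\<lambda>y. y * profile a y",
        OF mild_solution_mono[OF w assms(1)] mild_solution_bounded[OF w assms]] ..
  then show ?thesis
    unfolding mass_def by (simp add: tendsto_Lim)
qed

lemma profile_le_mass:
  assumes "0 \<le> a" "a < 1 / 2" "0 \<le> y"
  shows "y * profile a y \<le> mass a"
  by (rule le_limit_at_top[OF mild_solution_mono[OF mild_solution_profile] profile_tendsto_mass])
    (use assms in auto)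

text \<open>
  The tails \<open>mass a - y * profile a y\<close> increase with \<open>a\<close>, hence the convergence to \<open>mass\<close> is
  uniform on \<open>{0..c}\<close>.
\<close>

lemma mass_tail_le:
  assumes ac: "0 \<le> a" "a \<le> c" "c < 1 / 2" and y: "0 \<le> y"
  shows "mass a - y * profile a y \<le> mass c - y * profile c y"
proof (cases "a = c")
  case False
  then have "a < c" using ac by simp
  have a: "mild_solution a (profile a)" and c: "mild_solution c (profile c)"
    using ac by (auto intro!: mild_solution_profile)
  have "((\<lambda>y. y * profile c y - y * profile a y) \<longlongrightarrow> mass c - mass a) at_top"
    by (intro tendsto_diff profile_tendsto_mass) (use ac in auto)
  then have "y * profile c y - y * profile a y \<le> mass c - mass a"
    by (rule le_limit_at_top[of "\<lambda>y. y * profile c y - y * profile a y", rotated])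
      (use y mild_solution_diff_mono[OF a c ac(1) \<open>a < c\<close>] in auto)
  then show ?thesis by simp
qed simp

lemma continuous_on_profile:
  assumes "0 \<le> y"
  shows "continuous_on {0..1 / 2} (\<lambda>a. y * profile a y)"
proof (rule lipschitz_on_continuous_on, rule lipschitz_onI)
  fix a b :: real assume ab: "a \<in> {0..1 / 2}" "b \<in> {0..1 / 2}"
  have "\<bar>profile a y - profile b y\<bar> \<le> \<bar>a - b\<bar> * exp (y / 4)"
    by (rule mild_solution_lipschitz) (use ab assms mild_solution_profile profile_le in auto)
  then have "y * \<bar>profile a y - profile b y\<bar> \<le> y * (\<bar>a - b\<bar> * exp (y / 4))"
    using assms by (rule mult_left_mono)
  then show "dist (y * profile a y) (y * profile b y) \<le> y * exp (y / 4) * dist a b"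
    using assms by (simp add: dist_real_def abs_mult ac_simps flip: right_diff_distrib)
qed (use assms in simp)

lemma continuous_on_mass:
  assumes "c < 1 / 2"
  shows "continuous_on {0..c} mass"
proof (cases "0 \<le> c")
  case c: True
  show ?thesis
  proof (rule uniform_limit_theorem)
    show "\<forall>\<^sub>F y in at_top. continuous_on {0..c} (\<lambda>a. y * profile a y)"
      using eventually_ge_at_top[of 0]
      by eventually_elim (use assms in \<open>auto intro: continuous_on_subset[OF continuous_on_profile]\<close>)
    show "uniform_limit {0..c} (\<lambda>y a. y * profile a y) mass at_top"
    proof (rule uniform_limitI)
      fix e :: real assume "0 < e"
      \<comment> \<open>The largest slope has the largest tail, so its threshold serves for all of
        \<open>{0..c}\<close>.\<close>
      then have "\<forall>\<^sub>F y in at_top. dist (y * profile c y) (mass c) < e"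
        using profile_tendsto_mass[OF c assms] by (rule tendstoD[rotated])
      then show "\<forall>\<^sub>F y in at_top. \<forall>a\<in>{0..c}. dist (y * profile a y) (mass a) < e"
        using eventually_ge_at_top[of 0]
      proof eventually_elim
        case (elim y)
        show ?case
        proof
          fix a assume "a \<in> {0..c}"
          then show "dist (y * profile a y) (mass a) < e"
            using mass_tail_le[of a c y] profile_le_mass[of a y] assms elim
            by (auto simp: dist_real_def)
        qed
      qed
    qed
  qed simp
qed simp

section \<open>Range of the limit\<close>

text \<open>By continuous dependence, slopes near 1/2 follow the unbounded solution
  \<open>y / 2\<close> up to any prescribed point, and the limit is at least the value
  there.\<close>

lemma mass_unbounded:
  assumes "0 \<le> M"
  shows "\<exists>c. 0 \<le> c \<and> c < 1 / 2 \<and> M < mass c"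
proof -
  \<comment> \<open>Here \<open>y / 2 = M + 1\<close>, and \<open>d\<close> makes the Lipschitz
    error \<open>d * exp (y / 4)\<close> equal to \<open>1 / (2 * y)\<close>. Thus the solution at
    \<open>y\<close> is at least \<open>y / 2 - 1 / 2 = M + 1 / 2\<close>.\<close>
  define y where "y = 2 * M + 2"
  define d where "d = exp (- y / 4) / (2 * y)"
  have y: "2 \<le> y" using assms by (simp add: y_def)
  have "d \<le> 1 / (2 * y)"
    unfolding d_def using y by (intro divide_right_mono) auto
  also have "\<dots> \<le> 1 / 4"
    using y by (simp add: field_simps)
  finally have d: "0 < d" "d \<le> 1 / 4"
    using y by (auto simp: d_def)
  let ?c = "1 / 2 - d"
  have "\<bar>profile ?c y - 1 / 2\<bar> \<le> \<bar>?c - 1 / 2\<bar> * exp (y / 4)"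
    by (rule mild_solution_lipschitz[OF _ mild_solution_half])
      (use d y mild_solution_profile profile_le in auto)
  also have "\<dots> = 1 / (2 * y)"
    using d y by (simp add: d_def flip: exp_add)
  finally have "y * (1 / 2 - 1 / (2 * y)) \<le> y * profile ?c y"
    using y by (intro mult_left_mono) auto
  also have "\<dots> \<le> mass ?c"
    using d y by (intro profile_le_mass) auto
  finally have "M < mass ?c"
    using y assms by (simp add: right_diff_distrib) (simp add: y_def field_simps)
  then show ?thesis
    using d by (intro exI[of _ ?c]) auto
qed

lemma mass_0: "mass 0 = 0"
proof -
  have "y * profile 0 y = 0" if "0 \<le> y" for y
    unfolding mild_solution_eq[OF mild_solution_profile that, of 0, simplified]
    by (simp add: flux_def[abs_def])
  then have "\<forall>\<^sub>F y in at_top. 0 = y * profile 0 y"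
    by (intro eventually_mono[OF eventually_ge_at_top[of 0]]) auto
  then have "((\<lambda>y. y * profile 0 y) \<longlongrightarrow> 0) at_top"
    by (rule Lim_transform_eventually[OF tendsto_const])
  then show ?thesis
    using tendsto_unique[OF _ profile_tendsto_mass[of 0]] by auto
qed

lemma mass_attains:
  assumes "0 \<le> M"
  shows "\<exists>a. 0 \<le> a \<and> a < 1 / 2 \<and> mass a = M"
proof -
  obtain c where c: "0 \<le> c" "c < 1 / 2" "M < mass c"
    using mass_unbounded[OF assms] by blast
  have "\<exists>a\<ge>0. a \<le> c \<and> mass a = M"
    by (rule IVT'[OF _ _ c(1) continuous_on_mass[OF c(2)]]) (use assms c mass_0 in auto)
  then show ?thesis
    using c by auto
qed

section \<open>The limit determines the slope\<close>

text \<open>A slope of at least 1/2 would dominate every profile of smaller slope, and the limits of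
  those exceed any \<open>M\<close>.\<close>

lemma mild_solution_slope_less_half:
  assumes w: "mild_solution a w" and lim: "((\<lambda>y. y * w y) \<longlongrightarrow> M) at_top" and "0 \<le> M"
  shows "a < 1 / 2"
proof (rule ccontr)
  assume a: "\<not> a < 1 / 2"
  obtain c where c: "0 \<le> c" "c < 1 / 2" "M < mass c"
    using mass_unbounded[OF assms(3)] by blast
  have c_sol: "mild_solution c (profile c)"
    using c by (intro mild_solution_profile) auto
  have "\<forall>\<^sub>F y in at_top. y * profile c y \<le> y * w y"
    using eventually_ge_at_top[of 0]
  proof eventually_elim
    case (elim y)
    then show ?case
      using mild_solution_less[OF c_sol w c(1) _ elim] a c by (intro mult_left_mono) auto
  qed
  then have "mass c \<le> M"
    by (rule tendsto_le[OF _ lim profile_tendsto_mass[OF c(1,2)], rotated]) simp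
  then show False
    using c by simp
qed

text \<open>A nonpositive slope makes the flux, and so the solution, nonpositive. This brings
  arbitrary slopes into the range of the comparison lemmas.\<close>

lemma mild_solution_slope_pos:
  assumes w: "mild_solution a w" and lim: "((\<lambda>y. y * w y) \<longlongrightarrow> M) at_top" and "0 < M"
  shows "0 < a"
proof (rule ccontr)
  assume a: "\<not> 0 < a"
  have "y * w y \<le> 0 * y" if "0 \<le> y" for y
    unfolding mild_solution_eq[OF w that]
    by (rule integral_le_linear[OF mild_solution_flux_integrable[OF w]])
      (use a that in \<open>auto simp: flux_def mult_nonpos_nonneg\<close>)
  then have "\<forall>\<^sub>F y in at_top. y * w y \<le> 0"
    by (intro eventually_mono[OF eventually_ge_at_top[of 0]]) auto
  then have "M \<le> 0"
    by (rule tendsto_upperbound[OF lim]) simp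
  then show False using assms(3) by simp
qed

text \<open>If \<open>a < b\<close>, the proportional comparison passes to the limit as
  \<open>b * M \<le> a * M\<close>, contradicting \<open>M > 0\<close>. Exchanging the roles gives
  equality.\<close>

lemma mild_solution_slope_unique:
  assumes w: "mild_solution a w" and v: "mild_solution b v" and M: "0 < M"
    and lims: "((\<lambda>y. y * w y) \<longlongrightarrow> M) at_top" "((\<lambda>y. y * v y) \<longlongrightarrow> M) at_top"
  shows "b \<le> a"
proof (rule ccontr)
  assume "\<not> b \<le> a"
  then have ab: "0 \<le> a" "a < b"
    using mild_solution_slope_pos[OF w lims(1) M] by auto
  have "\<forall>\<^sub>F y in at_top. b * (y * w y) \<le> a * (y * v y)"
    using eventually_ge_at_top[of 0]
    by eventually_elim (rule mild_solution_scale_le[OF w v ab])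
  then have "b * M \<le> a * M"
    by (intro tendsto_le[OF _ tendsto_mult_left[OF lims(2)] tendsto_mult_left[OF lims(1)]]) auto
  then show False
    using ab M by simp
qed

subsection \<open>Solutions of the differential equation\<close>

text \<open>The witnesses are \<open>flux a w\<close> and its derivative by the chain rule;
  substituting \<xi> y / y = \<open>w y\<close> gives the equation. The restriction fixes the values
  on negative arguments, as the extensional function space in the theorem demands.\<close>

lemma is_solution_mild_solution:
  assumes w: "mild_solution a w"
  shows "is_solution (restrict (\<lambda>y. y * w y) {0..})"
proof -
  let ?f = "\<lambda>y. flux a w y * (w y / 2 - 1 / 4)"
  note cont = mild_solution_continuous_on[OF w] mild_solution_continuous_on_flux[OF w]
  have "(restrict (\<lambda>y. y * w y) {0..} has_real_derivative flux a w y) (at y within {0..})"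
    if "0 \<le> y" for y
    by (rule has_field_derivative_transform_within[OF mild_solution_has_derivative[OF w that]
          zero_less_one]) (use that in auto)
  moreover have "(flux a w has_real_derivative ?f y) (at y)" if "0 < y" for y
  proof -
    have *: "((\<lambda>x. integral {0..x} w) has_real_derivative w y) (at y)"
      using has_real_derivative_integral[OF cont(1), of y] that by (simp add: at_within_atLeast_eq)
    show ?thesis
      unfolding flux_def[abs_def]
      by (auto intro!: derivative_eq_intros * simp: algebra_simps)
  qed
  moreover have "continuous_on {0<..} ?f"
    by (intro continuous_on_mult continuous_on_diff continuous_on_divide continuous_on_const
        continuous_on_subset[OF cont(1)] continuous_on_subset[OF cont(2)]) auto
  moreover have "?f y + 1 / 4 * flux a w y
      - 1 / (2 * y) * restrict (\<lambda>y. y * w y) {0..} y * flux a w y = 0" if "0 < y" for y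
    using that by (simp add: field_simps)
  ultimately show ?thesis
    unfolding is_solution_def using cont(2)
    by (intro exI[of _ "flux a w"] exI[of _ ?f]) simp
qed

text \<open>
  The equation says that the logarithmic derivative of \<open>\<xi>'\<close> is \<open>\<xi> y / (2 * y) - 1 / 4\<close>, so
  dividing \<open>\<xi>'\<close> by the corresponding exponential gives a constant, \<open>\<xi>' 0\<close>.
\<close>

lemma is_solution_obtain_mild_solution:
  assumes "is_solution \<xi>" "\<xi> 0 = 0"
  obtains a w where "mild_solution a w" "\<And>y. 0 \<le> y \<Longrightarrow> \<xi> y = y * w y"
proof -
  obtain p q where p: "\<And>y. 0 \<le> y \<Longrightarrow> (\<xi> has_real_derivative p y) (at y within {0..})"
    and p_cont: "continuous_on {0..} p"
    and q: "\<And>y. 0 < y \<Longrightarrow> (p has_real_derivative q y) (at y)"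
    and ode: "\<And>y. 0 < y \<Longrightarrow> q y + 1 / 4 * p y - 1 / (2 * y) * \<xi> y * p y = 0"
    using assms(1) unfolding is_solution_def by blast
  define w where "w y = (if y = 0 then p 0 else \<xi> y / y)" for y
  have "continuous_on {0..} \<xi>"
    by (rule DERIV_continuous_on[OF p]) auto
  then have w_cont: "continuous_on {0..} w"
    unfolding w_def[abs_def] using assms(2) p[of 0] by (intro continuous_on_quotient_at_0) auto
  have \<xi>_eq: "\<xi> y = y * w y" if "0 \<le> y" for y
    using assms(2) by (simp add: w_def)
  have p_eq: "p y = flux (p 0) w y" if y: "0 \<le> y" for y
  proof (cases "y = 0")
    case False
    let ?h = "\<lambda>x. p x * exp (x / 4 - integral {0..x} w / 2)"
    have "?h y = ?h 0"
    proof (rule DERIV_isconst_end[where f = ?h])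
      show "0 < y" using y False by simp
      show "continuous_on {0..y} ?h"
        by (intro continuous_intros indefinite_integral_continuous_1 integrable_on_Icc[OF w_cont]
            continuous_on_subset[OF p_cont]) auto
      fix x assume x: "0 < x" "x < y"
      have "((\<lambda>x. integral {0..x} w) has_real_derivative w x) (at x)"
        using has_real_derivative_integral[OF w_cont, of x] x by (simp add: at_within_atLeast_eq)
      then have "(?h has_real_derivative
          (q x + p x * (1 / 4 - w x / 2)) * exp (x / 4 - integral {0..x} w / 2)) (at x)"
        by (auto intro!: derivative_eq_intros q x simp: algebra_simps)
      moreover have "q x + p x * (1 / 4 - w x / 2) = 0"
        using ode[OF x(1)] x by (simp add: w_def algebra_simps)
      ultimately show "(?h has_real_derivative 0) (at x)"
        by simp
    qed
    then have "p y * exp (y / 4 - integral {0..y} w / 2) * exp (integral {0..y} w / 2 - y / 4)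
        = p 0 * exp (integral {0..y} w / 2 - y / 4)"
      by simp
    then show ?thesis
      by (simp add: flux_def mult.assoc flip: exp_add)
  qed simp
  have "y * w y = integral {0..y} (flux (p 0) w)" if y: "0 \<le> y" for y
  proof -
    have "(p has_integral \<xi> y - \<xi> 0) {0..y}"
    proof (rule fundamental_theorem_of_calculus[OF y])
      fix x assume "x \<in> {0..y}"
      then show "(\<xi> has_vector_derivative p x) (at x within {0..y})"
        using DERIV_subset[OF p, of x "{0..y}"]
        by (auto simp: has_real_derivative_iff_has_vector_derivative)
    qed
    then have "integral {0..y} p = y * w y"
      using \<xi>_eq[OF y] assms(2) by (simp add: integral_unique)
    moreover have "integral {0..y} p = integral {0..y} (flux (p 0) w)"
      by (rule integral_cong, rule p_eq) simp
    ultimately show ?thesis by simp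
  qed
  then have "mild_solution (p 0) w"
    using w_cont by (auto simp: mild_solution_def w_def)
  then show thesis
    using \<xi>_eq by (rule that)
qed

theorem theorem4p1:
  fixes M :: real
  assumes "M > 0"
  shows "\<exists>!\<xi>. \<xi> \<in> {0..} \<rightarrow>\<^sub>E (UNIV :: real set) \<and> is_solution \<xi> \<and> \<xi> 0 = 0 \<and> (\<xi> \<longlongrightarrow> M) at_top"
proof (rule ex_ex1I)
  obtain a where a: "0 \<le> a" "a < 1 / 2" "mass a = M"
    using mass_attains[of M] assms by auto
  let ?\<xi> = "restrict (\<lambda>y. y * profile a y) {0..}"
  have "(?\<xi> \<longlongrightarrow> M) at_top"
  proof (rule Lim_transform_eventually)
    show "((\<lambda>y. y * profile a y) \<longlongrightarrow> M) at_top"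
      using profile_tendsto_mass[OF a(1,2)] a(3) by simp
    show "\<forall>\<^sub>F y in at_top. y * profile a y = ?\<xi> y"
      using eventually_ge_at_top[of 0] by eventually_elim simp
  qed
  moreover have "is_solution ?\<xi>"
    using a by (intro is_solution_mild_solution[of a] mild_solution_profile) auto
  ultimately show "\<exists>\<xi>. \<xi> \<in> {0..} \<rightarrow>\<^sub>E (UNIV :: real set) \<and> is_solution \<xi> \<and> \<xi> 0 = 0 \<and>
      (\<xi> \<longlongrightarrow> M) at_top"
    by (intro exI[of _ ?\<xi>]) auto
next
  fix \<xi> \<eta> :: "real \<Rightarrow> real"
  assume \<xi>: "\<xi> \<in> {0..} \<rightarrow>\<^sub>E UNIV \<and> is_solution \<xi> \<and> \<xi> 0 = 0 \<and> (\<xi> \<longlongrightarrow> M) at_top"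
    and \<eta>: "\<eta> \<in> {0..} \<rightarrow>\<^sub>E UNIV \<and> is_solution \<eta> \<and> \<eta> 0 = 0 \<and> (\<eta> \<longlongrightarrow> M) at_top"
  obtain a w where w: "mild_solution a w" and \<xi>_eq: "\<And>y. 0 \<le> y \<Longrightarrow> \<xi> y = y * w y"
    using is_solution_obtain_mild_solution \<xi> by blast
  obtain b v where v: "mild_solution b v" and \<eta>_eq: "\<And>y. 0 \<le> y \<Longrightarrow> \<eta> y = y * v y"
    using is_solution_obtain_mild_solution \<eta> by blast
  have w_lim: "((\<lambda>y. y * w y) \<longlongrightarrow> M) at_top"
    by (rule Lim_transform_eventually[of \<xi>])
      (use \<xi> \<xi>_eq in \<open>auto intro: eventually_mono[OF eventually_ge_at_top[of 0]]\<close>)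
  have v_lim: "((\<lambda>y. y * v y) \<longlongrightarrow> M) at_top"
    by (rule Lim_transform_eventually[of \<eta>])
      (use \<eta> \<eta>_eq in \<open>auto intro: eventually_mono[OF eventually_ge_at_top[of 0]]\<close>)
  have "a = b"
    using mild_solution_slope_unique[OF w v assms w_lim v_lim]
      mild_solution_slope_unique[OF v w assms v_lim w_lim] by simp
  moreover have "0 < a" "a < 1 / 2"
    using mild_solution_slope_pos[OF w w_lim assms] mild_solution_slope_less_half[OF w w_lim] assms
    by auto
  ultimately have "w y = v y" if "0 \<le> y" for y
    using mild_solution_unique[OF w, of v y] v that by simp
  \<comment> \<open>Both functions take the same default value outside \<open>{0..}\<close>, so
    agreement on the half-line is equality.\<close>
  then show "\<xi> = \<eta>"
    using \<xi> \<eta> \<xi>_eq \<eta>_eq by (intro PiE_ext[of \<xi> "{0..}" "\<lambda>_. UNIV" \<eta>]) auto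
qed

end
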